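(* Let $R$ be a principal ideal domain and let $I=gR\subsetneq R$ be a proper, non-prime ideal such that $Q:=R/I$ is finite. Write $g=u\cdot\prod_{i=1}^n p_i^{m_i}$ with $u$ a unit, $p_1,\dots,p_n$ pairwise non-associated prime elements and integers $m_1,\dots,m_n\ge 1$, and let $\bm{m}=(m_1,\dots,m_n)$. If $n\ge 3$, then the graph $\Gamma_{E'}(Q)$ is isomorphic to the integral covering graph $D(\bm{m})$.
   Context: Rings are commutative and non-zero with $1$. For a ring $Q$, $Z(Q)$ is the set of $r\in Q$ for which there is $s\in Q\setminus\{0\}$ with $rs=0$. The zero divisor graph $\Gamma(Q)$ has vertex set $Z(Q)\setminus\{0\}$; two distinct vertices $r,s$ are adjacent iff $rs=0$. For a graph $G=(V,E)$ with neighbourhoods $N(\cdot)$, define $u\sim' v$ if $N(u)\setminus\{u,v\}=N(v)\setminus\{u,v\}$; this is an equivalence relation, with classes $[v]'$. The graph $G_{E'}$ has vertex set $\{[v]'\colon v\in V\}$ and edge set $\{\{[u]',[v]'\}\colon [u]'\ne[v]' \text{ and } \{u,v\}\in E\}$. $\Gamma_{E'}(Q)$ denotes $G_{E'}$ for $G=\Gamma(Q)$. For $\bm{m}\in\mathbb{Z}_{\ge 1}^n$, the integral covering graph $D(\bm{m})$ has vertex set $\prod_{i=1}^n \{0,1,\dots,m_i\}\setminus\{\bm{0},\bm{m}\}$, and two distinct vertices $\bm v,\bm w$ are adjacent iff $v_i+w_i\ge m_i$ for all $i\in\{1,\dots,n\}$. *)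

theory Defs
  imports "HOL-Algebra.Algebra"
begin

record 'a sgraph =
  sverts :: "'a set"
  sedges :: "'a set set"

definition nbhd :: "'a sgraph \<Rightarrow> 'a \<Rightarrow> 'a set" where
  "nbhd G v = {w \<in> sverts G. {v, w} \<in> sedges G}"

definition graph_isomorphic :: "'a sgraph \<Rightarrow> 'b sgraph \<Rightarrow> bool" where
  "graph_isomorphic G H \<longleftrightarrow>
     (\<exists>f. bij_betw f (sverts G) (sverts H) \<and>
          (\<forall>u\<in>sverts G. \<forall>v\<in>sverts G. {u, v} \<in> sedges G \<longleftrightarrow> {f u, f v} \<in> sedges H))"

definition twin_rel :: "'a sgraph \<Rightarrow> 'a rel" where
  "twin_rel G = {(u, v) \<in> sverts G \<times> sverts G. nbhd G u - {u, v} = nbhd G v - {u, v}}"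

definition twin_reduction :: "'a sgraph \<Rightarrow> 'a set sgraph" where
  "twin_reduction G =
     \<lparr>sverts = sverts G // twin_rel G,
      sedges = {{twin_rel G `` {u}, twin_rel G `` {v}} | u v.
                  twin_rel G `` {u} \<noteq> twin_rel G `` {v} \<and> {u, v} \<in> sedges G}\<rparr>"

(* Zero itself belongs to this set when the ring is non-zero. *)
definition zero_divisors :: "('a, 'b) ring_scheme \<Rightarrow> 'a set" where
  "zero_divisors Q =
     {r \<in> carrier Q. \<exists>s \<in> carrier Q - {\<zero>\<^bsub>Q\<^esub>}. r \<otimes>\<^bsub>Q\<^esub> s = \<zero>\<^bsub>Q\<^esub>}"

definition zero_divisor_graph :: "('a, 'b) ring_scheme \<Rightarrow> 'a sgraph" where
  "zero_divisor_graph Q =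
     (let V = zero_divisors Q - {\<zero>\<^bsub>Q\<^esub>} in
      \<lparr>sverts = V,
       sedges = {{r, s} | r s. r \<in> V \<and> s \<in> V \<and> r \<noteq> s \<and> r \<otimes>\<^bsub>Q\<^esub> s = \<zero>\<^bsub>Q\<^esub>}\<rparr>)"

(* Vectors of length n are functions on {1..n}, extended by undefined outside;
   the values of m outside {1..n} are irrelevant. *)
definition integral_covering_graph :: "nat \<Rightarrow> (nat \<Rightarrow> nat) \<Rightarrow> (nat \<Rightarrow> nat) sgraph" where
  "integral_covering_graph n m =
     (let V = (\<Pi>\<^sub>E i\<in>{1..n}. {0..m i}) - {\<lambda>i\<in>{1..n}. 0, \<lambda>i\<in>{1..n}. m i} in
      \<lparr>sverts = V,
       sedges = {{v, w} | v w. v \<in> V \<and> w \<in> V \<and> v \<noteq> w \<and> (\<forall>i\<in>{1..n}. m i \<le> v i + w i)}\<rparr>)"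

end

theory Submission
  imports Defs
begin

text \<open>Send a residue class x + I to the vector of its p_i-adic valuations, truncated at m_i. This is
  well defined and onto, and a product vanishes in R/I iff the two vectors add up to at least m in
  every coordinate. So elements with the same vector are twins. Conversely, distinct vectors
  a and b are told apart by some c outside {0, m, a, b} that is adjacent to exactly one of them;
  three coordinates leave enough freedom to avoid the four forbidden values.\<close>

section \<open>Twin reductions\<close>

text \<open>Adjacency in \<open>G\<close> between distinct vertices depends only on
  \<open>f\<close>, so vertices with equal image are twins; \<open>separated\<close> gives the
  converse. The twin classes are thus the fibres of \<open>f\<close>, and \<open>f\<close> descends
  to a bijection onto the vertices of \<open>H\<close>. The witness must avoid \<open>a\<close> and
  \<open>b\<close> because the twin relation ignores the two vertices being compared.\<close>

lemma twin_reduction_isomorphicI: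
  fixes G :: "'a sgraph" and H :: "'b sgraph" and f :: "'a \<Rightarrow> 'b"
  assumes surj: "f ` sverts G = sverts H"
    and edges_sub: "\<And>u v. {u, v} \<in> sedges G \<Longrightarrow> u \<in> sverts G"
    and adjG: "\<And>u v. u \<in> sverts G \<Longrightarrow> v \<in> sverts G \<Longrightarrow> u \<noteq> v \<Longrightarrow>
                 {u, v} \<in> sedges G \<longleftrightarrow> P (f u) (f v)"
    and adjH: "\<And>a b. a \<in> sverts H \<Longrightarrow> b \<in> sverts H \<Longrightarrow>
                 {a, b} \<in> sedges H \<longleftrightarrow> a \<noteq> b \<and> P a b"
    and separated: "\<And>a b. a \<in> sverts H \<Longrightarrow> b \<in> sverts H \<Longrightarrow> a \<noteq> b \<Longrightarrow>
                 \<exists>c \<in> sverts H - {a, b}. P a c \<noteq> P b c"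
  shows "graph_isomorphic (twin_reduction G) H"
proof -
  let ?V = "sverts G"
  have nbhd_iff: "w \<in> nbhd G u \<longleftrightarrow> w \<in> ?V \<and> P (f u) (f w)"
    if "u \<in> ?V" "w \<noteq> u" for u w
    using that adjG[of u w] by (auto simp: nbhd_def)
  have twin_iff: "(u, v) \<in> twin_rel G \<longleftrightarrow> u \<in> ?V \<and> v \<in> ?V \<and> f u = f v" for u v
  proof
    assume uv: "u \<in> ?V \<and> v \<in> ?V \<and> f u = f v"
    have "nbhd G u - {u, v} = nbhd G v - {u, v}"
      using uv nbhd_iff by auto
    with uv show "(u, v) \<in> twin_rel G" by (simp add: twin_rel_def)
  next
    assume "(u, v) \<in> twin_rel G"
    then have uv: "u \<in> ?V" "v \<in> ?V" and eq: "nbhd G u - {u, v} = nbhd G v - {u, v}"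
      by (auto simp: twin_rel_def)
    have "f u = f v"
    proof (rule ccontr)
      assume "f u \<noteq> f v"
      then obtain c where c: "c \<in> sverts H" "c \<noteq> f u" "c \<noteq> f v" "P (f u) c \<noteq> P (f v) c"
        using separated[of "f u" "f v"] uv surj by blast
      then obtain w where w: "w \<in> ?V" "c = f w" using surj by blast
      \<comment> \<open>Lying outside \<open>{u, v}\<close>, the vertex \<open>w\<close> is not
        removed from either neighbourhood, so \<open>eq\<close> says something about it.\<close>
      with c have "w \<noteq> u" "w \<noteq> v" by auto
      with eq have "w \<in> nbhd G u \<longleftrightarrow> w \<in> nbhd G v" by blast
      with nbhd_iff uv w c \<open>w \<noteq> u\<close> \<open>w \<noteq> v\<close> show False by blast
    qed
    with uv show "u \<in> ?V \<and> v \<in> ?V \<and> f u = f v" by simp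
  qed
  define cls where "cls u = twin_rel G `` {u}" for u
  have cls: "cls u = {v \<in> ?V. f v = f u}" if "u \<in> ?V" for u
    using that twin_iff by (auto simp: cls_def)
  have cls_eq: "cls u = cls v \<longleftrightarrow> f u = f v" if "u \<in> ?V" "v \<in> ?V" for u v
    using that cls by auto
  \<comment> \<open>Any representative will do, since \<open>f\<close> is constant on each
    class.\<close>
  define F where "F C = f (SOME u. u \<in> C)" for C
  have F: "F (cls u) = f u" if "u \<in> ?V" for u
  proof -
    have "u \<in> cls u" using that cls by blast
    then have "(SOME x. x \<in> cls u) \<in> cls u" by (rule someI)
    with that cls show ?thesis by (simp add: F_def)
  qed
  have verts: "sverts (twin_reduction G) = cls ` ?V"
    by (auto simp: twin_reduction_def quotient_def cls_def)
  have edges: "sedges (twin_reduction G) =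
      {{cls u, cls v} | u v. cls u \<noteq> cls v \<and> {u, v} \<in> sedges G}"
    by (simp add: twin_reduction_def cls_def)
  have edge_iff: "{cls u, cls v} \<in> sedges (twin_reduction G) \<longleftrightarrow> {f u, f v} \<in> sedges H"
    if uv: "u \<in> ?V" "v \<in> ?V" for u v
  proof -
    have fV: "f u \<in> sverts H" "f v \<in> sverts H" using uv surj by auto
    \<comment> \<open>Symmetry of \<open>P\<close> on distinct vertices of \<open>H\<close> comes
      from the edges being unordered pairs.\<close>
    have H: "{f u, f v} \<in> sedges H \<longleftrightarrow> f u \<noteq> f v \<and> P (f u) (f v)"
      and H': "{f u, f v} \<in> sedges H \<longleftrightarrow> f u \<noteq> f v \<and> P (f v) (f u)"
      using adjH[OF fV] adjH[OF fV(2,1)] insert_commute[of "f u" "f v" "{}"] by metis+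
    show ?thesis
    proof
      assume "{cls u, cls v} \<in> sedges (twin_reduction G)"
      then obtain x y where xy: "{cls u, cls v} = {cls x, cls y}" "cls x \<noteq> cls y"
          "{x, y} \<in> sedges G"
        unfolding edges by (elim CollectE exE conjE) (rule that)
      from xy(3) have V: "x \<in> ?V" "y \<in> ?V"
        using edges_sub[of x y] edges_sub[of y x] insert_commute[of x y "{}"] by metis+
      have "x \<noteq> y" "f x \<noteq> f y" using xy(2) cls_eq V by auto
      then have "P (f x) (f y)" using adjG[OF V] xy(3) by blast
      \<comment> \<open>The edge may be witnessed by other representatives and in the opposite
        order, hence both \<open>H\<close> and \<open>H'\<close>.\<close>
      have "(f u = f x \<and> f v = f y) \<or> (f u = f y \<and> f v = f x)"
        using xy(1) V uv cls_eq by (auto simp: doubleton_eq_iff)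
      with \<open>P (f x) (f y)\<close> \<open>f x \<noteq> f y\<close> show "{f u, f v} \<in> sedges H" using H H' by metis
    next
      assume "{f u, f v} \<in> sedges H"
      with H have ne: "f u \<noteq> f v" and "P (f u) (f v)" by auto
      with adjG[OF uv] have "{u, v} \<in> sedges G" by blast
      moreover have "cls u \<noteq> cls v" using ne uv cls_eq by simp
      ultimately show "{cls u, cls v} \<in> sedges (twin_reduction G)"
        unfolding edges by blast
    qed
  qed
  have "bij_betw F (cls ` ?V) (sverts H)"
    unfolding bij_betw_def
    using F cls_eq surj by (auto simp: inj_on_def image_image)
  then show ?thesis
    unfolding graph_isomorphic_def verts using edge_iff F
    by (intro exI[of _ F]) (auto simp: F)
qed

text \<open>At a coordinate i with a i < b i, the entry m i - b i suffices for b but not for a. The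
  other entries only have to be compatible with b, and varying them avoids the forbidden vectors. If
  b leaves no such room, a vector adjacent to a but not to b is used instead.\<close>

lemma integral_covering_graph_separated:
  fixes n :: nat and m a b :: "nat \<Rightarrow> nat"
  defines "V \<equiv> sverts (integral_covering_graph n m)"
  assumes n: "n \<ge> 3" and m: "\<And>i. i \<in> {1..n} \<Longrightarrow> m i \<ge> 1"
    and aV: "a \<in> V" and bV: "b \<in> V" and ab: "a \<noteq> b"
  shows "\<exists>c \<in> V - {a, b}. (\<forall>i\<in>{1..n}. m i \<le> a i + c i) \<noteq> (\<forall>i\<in>{1..n}. m i \<le> b i + c i)"
proof -
  have V: "V = (\<Pi>\<^sub>E i\<in>{1..n}. {0..m i}) - {\<lambda>i\<in>{1..n}. 0, \<lambda>i\<in>{1..n}. m i}"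
    by (simp add: V_def integral_covering_graph_def)
  \<comment> \<open>The claim is symmetric in a and b, so a strict inequality at some coordinate may
    be assumed.\<close>
  have less: "\<exists>c \<in> V - {a, b}. (\<forall>i\<in>{1..n}. m i \<le> a i + c i) \<noteq> (\<forall>i\<in>{1..n}. m i \<le> b i + c i)"
    if aV: "a \<in> V" and bV: "b \<in> V" and i: "i \<in> {1..n}" and lt: "a i < b i" for a b i
  proof -
    obtain j k where jk: "j \<in> {1..n}" "k \<in> {1..n}" "j \<noteq> i" "k \<noteq> i" "j \<noteq> k"
    proof -
      have "{1, 2, 3} \<subseteq> {1..n}" using n by auto
      then show ?thesis using that[of 2 3] that[of 1 3] that[of 1 2] by fastforce
    qed
    have bi: "b i \<le> m i" using bV i unfolding V by (auto simp: PiE_iff)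
    \<comment> \<open>In coordinate i the smallest value compatible with b, which is too small for a.\<close>
    define c where "c x = (\<lambda>l\<in>{1..n}. if l = i then m i - b i else x l)" for x
    \<comment> \<open>Entry i is below m i because b i > 0, which excludes the vector m; the
      positive entry at \<open>l\<close> excludes the zero vector. Only a and b are left to
      avoid.\<close>
    have c_works: "\<exists>c \<in> V - {a, b}. (\<forall>i\<in>{1..n}. m i \<le> a i + c i) \<noteq> (\<forall>i\<in>{1..n}. m i \<le> b i + c i)"
      if x: "\<And>l. l \<in> {1..n} \<Longrightarrow> l \<noteq> i \<Longrightarrow> x l \<le> m l \<and> m l \<le> b l + x l"
        and l: "l \<in> {1..n}" "l \<noteq> i" "x l > 0"
        and ne: "c x \<noteq> a" "c x \<noteq> b" for x l
    proof (intro bexI[of _ "c x"])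
      have "c x l \<noteq> 0" using l by (simp add: c_def)
      moreover have "c x i < m i" using i lt bi by (simp add: c_def)
      moreover have "c x \<in> (\<Pi>\<^sub>E i\<in>{1..n}. {0..m i})" using x by (auto simp: c_def PiE_iff)
      ultimately show "c x \<in> V - {a, b}" using ne i l unfolding V by auto
      have "\<not> m i \<le> a i + c x i" using i lt bi by (simp add: c_def)
      moreover have "\<forall>i\<in>{1..n}. m i \<le> b i + c x i" using x bi by (auto simp: c_def)
      ultimately show "(\<forall>i\<in>{1..n}. m i \<le> a i + c x i) \<noteq> (\<forall>i\<in>{1..n}. m i \<le> b i + c x i)"
        using i by blast
    qed
    show ?thesis
    proof (cases "\<forall>l\<in>{1..n}. l \<noteq> i \<longrightarrow> b l = 0")
      case False
      then obtain j where j: "j \<in> {1..n}" "j \<noteq> i" "b j > 0" by blast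
      obtain k where k: "k \<in> {1..n}" "k \<noteq> i" "k \<noteq> j" using jk by metis
      have mpos: "m j > 0" "m k > 0" using m[of j] m[of k] j k by auto
      \<comment> \<open>Since b j > 0, lowering entry j by one keeps compatibility with b.\<close>
      let ?x = "m(j := m j - 1)"
      \<comment> \<open>\<open>c m\<close> and \<open>c ?x\<close> differ at j but agree at i. If
        both lay in \<open>{a, b}\<close>, they would be a and b in some order, contradicting a i <
        b i.\<close>
      consider "c m \<noteq> a" "c m \<noteq> b" | "c ?x \<noteq> a" "c ?x \<noteq> b" | "b k = m k" "c m = a"
      proof -
        have E: "c m j = m j" "c m k = m k" "c ?x j = m j - 1" "c ?x k = m k"
          using j k by (auto simp: c_def)
        have "c m i = c ?x i" using i j by (simp add: c_def)
        then show ?thesis using that E mpos lt by (metis diff_less less_numeral_extra(1) nat_neq_iff)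
      qed
      then show ?thesis
      proof cases
        case 1
        then show ?thesis using c_works[of m j] j mpos by auto
      next
        case 2
        show ?thesis by (rule c_works[of ?x k]) (use 2 j k mpos in auto)
      next
        case 3
        \<comment> \<open>Here a and b both have entry m k at k, so lowering that entry avoids
          both.\<close>
        let ?y = "m(k := m k - 1)"
        have E: "c ?y k = m k - 1" "c m k = m k"  using k by (auto simp: c_def)
        then have "c ?y \<noteq> a" "c ?y \<noteq> b" using 3 mpos by auto
        then show ?thesis by (intro c_works[of ?y j]) (use j k mpos 3 in auto)
      qed
    next
      case True
      have mpos: "m j > 0" "m k > 0" using m[of j] m[of k] jk by auto
      have "c m j = m j" using jk by (simp add: c_def)
      then have "c m \<noteq> b" using True jk mpos by force
      \<comment> \<open>Compatibility with b now forces the entries of m at all coordinates other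
        than i, so \<open>c m\<close> is the only candidate of this form, and it fails only if it
        equals a.\<close>
      show ?thesis
      proof (cases "c m = a")
        case False
        then show ?thesis using c_works[of m j] \<open>c m \<noteq> b\<close> jk mpos by auto
      next
        case eq: True
        then have a: "a l = m l" if "l \<in> {1..n}" "l \<noteq> i" for l
          using that by (auto simp: c_def)
        \<comment> \<open>Here b is concentrated in coordinate i, so separate in coordinate j, on the side of a.\<close>
        define d where "d = (\<lambda>l\<in>{1..n}. if l = j then 0 else m l)"
        have d: "d j = 0" "d k = m k" using jk by (auto simp: d_def)
        have "b k = 0" "b j = 0" using True jk by auto
        \<comment> \<open>Entry j separates \<open>d\<close> from a and from m; entry k separates it
          from b and from zero. Two coordinates besides i are used here.\<close>
        have "d \<noteq> a" "d \<noteq> b" "d \<noteq> (\<lambda>i\<in>{1..n}. 0)" "d \<noteq> (\<lambda>i\<in>{1..n}. m i)"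
          using d a[of j] jk mpos \<open>b k = 0\<close> by force+
        moreover have "d \<in> (\<Pi>\<^sub>E i\<in>{1..n}. {0..m i})" by (auto simp: d_def)
        moreover have "\<forall>i\<in>{1..n}. m i \<le> a i + d i" using a jk by (auto simp: d_def)
        moreover have "\<not> m j \<le> b j + d j" using d \<open>b j = 0\<close> mpos by simp
        ultimately show ?thesis using jk(1) unfolding V by blast
      qed
    qed
  qed
  obtain i where i: "i \<in> {1..n}" "a i \<noteq> b i"
    using ab aV bV unfolding V by (metis DiffD1 PiE_ext)
  then consider "a i < b i" | "b i < a i" by linarith
  then show ?thesis
  proof cases
    case 2
    show ?thesis using less[OF bV aV i(1) 2] by blast
  qed (rule less[OF aV bV i(1)])
qed

section \<open>Truncated valuations\<close>

text \<open>As a simp rule this loops, its premise being an instance of its conclusion.\<close>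
declare divides_mult_imp_divides [simp del]

text \<open>The bound \<open>m\<close> keeps the set finite even for x = 0, which gets the value
  \<open>m\<close>. It also makes the value unchanged when a multiple of the \<open>m\<close>-th
  power of \<open>p\<close> is added to \<open>x\<close>.\<close>

definition trunc_val :: "('a, 'b) ring_scheme \<Rightarrow> 'a \<Rightarrow> nat \<Rightarrow> 'a \<Rightarrow> nat" where
  "trunc_val R p m x = Max {k. k \<le> m \<and> (p [^]\<^bsub>R\<^esub> k) divides\<^bsub>R\<^esub> x}"

context domain
begin

lemma pow_divides_pow:
  assumes "p \<in> carrier R" "i \<le> j"
  shows "p [^] i divides p [^] (j::nat)"
  using assms by (intro dividesI[of "p [^] (j - i)"]) (auto simp: nat_pow_mult)

lemma trunc_val_le [simp]:
  assumes "p \<in> carrier R" "x \<in> carrier R"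
  shows "trunc_val R p m x \<le> m"
    and "p [^] trunc_val R p m x divides x"
proof -
  let ?K = "{k. k \<le> m \<and> p [^] k divides x}"
  have "0 \<in> ?K" using assms one_divides by simp
  then have "Max ?K \<in> ?K" by (intro Max_in) auto
  then show "trunc_val R p m x \<le> m" "p [^] trunc_val R p m x divides x"
    by (auto simp: trunc_val_def)
qed

text \<open>Lower powers divide higher ones, so the exponents up to \<open>m\<close> that work form
  an initial segment.\<close>

lemma pow_divides_iff_trunc_val:
  assumes "p \<in> carrier R" "x \<in> carrier R" "j \<le> m"
  shows "p [^] j divides x \<longleftrightarrow> j \<le> trunc_val R p m x"
proof
  assume "p [^] j divides x"
  then show "j \<le> trunc_val R p m x"
    unfolding trunc_val_def using assms by (intro Max_ge) auto
next
  assume "j \<le> trunc_val R p m x"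
  then show "p [^] j divides x"
    using divides_trans[OF pow_divides_pow trunc_val_le(2)] assms by simp
qed

section \<open>Divisibility by prime elements in a domain\<close>

lemma ring_prime_not_divides_one:
  assumes "p \<in> carrier R" "ring_prime p"
  shows "\<not> p divides \<one>"
  using ring_primeE(3)[OF assms] divides_one[OF assms(1)] by (auto simp: prime_def)

lemma ring_prime_divides_mult:
  assumes "p \<in> carrier R" "ring_prime p" "x \<in> carrier R" "y \<in> carrier R"
  shows "p divides x \<otimes> y \<longleftrightarrow> p divides x \<or> p divides y"
  using ring_primeE(3)[OF assms(1,2)] assms(1,3,4) divides_prod_r[of p x y] divides_prod_l[of p y x]
  by (auto simp: prime_def)

lemma ring_prime_divides_pow:
  assumes "p \<in> carrier R" "ring_prime p" "x \<in> carrier R" "p divides x [^] (k::nat)"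
  shows "p divides x"
  using assms(4)
proof (induction k)
  case 0
  then show ?case using ring_prime_not_divides_one[OF assms(1,2)] by simp
next
  case (Suc k)
  then show ?case
    using ring_prime_divides_mult[OF assms(1,2), of "x [^] k" x] assms(3) by auto
qed

lemma ring_prime_divides_finprod:
  assumes "finite S" "p \<in> carrier R" "ring_prime p" "f \<in> S \<rightarrow> carrier R"
    and "p divides (\<Otimes>i\<in>S. f i)"
  shows "\<exists>i\<in>S. p divides f i"
  using assms(1,4,5)
proof (induction S)
  case empty
  then show ?case using ring_prime_not_divides_one[OF assms(2,3)] by simp
next
  case (insert j S)
  have carr: "f \<in> S \<rightarrow> carrier R" "f j \<in> carrier R" using insert.prems(1) by auto
  have "p divides f j \<otimes> (\<Otimes>i\<in>S. f i)"
    using insert.prems(2) finprod_insert[OF insert.hyps carr] by simp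
  then have "p divides f j \<or> p divides (\<Otimes>i\<in>S. f i)"
    using ring_prime_divides_mult[OF assms(2,3)] carr by simp
  then show ?case using insert.IH carr(1) by blast
qed

text \<open>If q = p c, then q divides p or c; the second option, after cancelling q, would make p a
  unit.\<close>

lemma ring_prime_divides_ring_prime:
  assumes "p \<in> carrier R" "ring_prime p" "q \<in> carrier R" "ring_prime q" "p divides q"
  shows "p \<sim> q"
proof -
  obtain c where c: "c \<in> carrier R" "q = p \<otimes> c" using assms(5) by blast
  have "q divides p \<or> q divides c"
    using ring_prime_divides_mult[OF assms(3,4,1) c(1)] c(2) assms(3) by auto
  moreover have "\<not> q divides c"
  proof
    assume "q divides c"
    then obtain d where d: "d \<in> carrier R" "c = q \<otimes> d" by blast
    have "q \<otimes> \<one> = p \<otimes> (q \<otimes> d)"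
      using trans[OF r_one[OF assms(3)] c(2)] unfolding d(2) .
    also have "\<dots> = q \<otimes> (p \<otimes> d)" using m_lcomm assms(1,3) d(1) by blast
    finally have "q \<otimes> \<one> = q \<otimes> (p \<otimes> d)" .
    then have "\<one> = p \<otimes> d"
      using m_lcancel[of q \<one> "p \<otimes> d"] ring_primeE(1)[OF assms(3,4)] assms d by simp
    then show False using ring_prime_not_divides_one[OF assms(1,2)] d(1) by blast
  qed
  ultimately show ?thesis using assms(5) by (simp add: associated_def)
qed

text \<open>This is cancellation of a factor prime to \<open>p\<close>, transferred from the monoid
  \<open>mult_of R\<close> of nonzero elements; hence x = 0 is treated apart.\<close>

lemma ring_prime_pow_divides_cancel:
  assumes "p \<in> carrier R" "ring_prime p" "a \<in> carrier R" "x \<in> carrier R" "\<not> p divides a"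
    and "p [^] (k::nat) divides a \<otimes> x"
  shows "p [^] k divides x"
proof (cases "x = \<zero>")
  case True
  then show ?thesis using divides_zero assms(1) by simp
next
  case False
  have "a \<noteq> \<zero>" using assms(1,5) divides_zero by auto
  have ax: "a \<otimes> x \<in> carrier R - {\<zero>}"
    using False \<open>a \<noteq> \<zero>\<close> assms(3,4) integral by blast
  have "p [^] k divides\<^bsub>mult_of R\<^esub> a \<otimes> x"
    using divides_imp_divides_mult[OF nat_pow_closed ax] assms(1,6) by blast
  moreover have "\<not> p divides\<^bsub>mult_of R\<^esub> a"
    using assms(5) divides_mult_imp_divides[where R = R] by metis
  ultimately have "p [^] k divides\<^bsub>mult_of R\<^esub> x"
    using mult_of.prime_pow_divides_iff[of p a x k] ring_primeE(1,2)[OF assms(1,2)]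
      False \<open>a \<noteq> \<zero>\<close> assms(1,3,4) by (simp add: nat_pow_mult_of)
  then show ?thesis by (rule divides_mult_imp_divides)
qed

text \<open>Valuations add up under products. Truncation does no harm: a truncated summand already
  reaches \<open>m\<close>, and if the sum stays below \<open>m\<close>, both values are the true
  valuations.\<close>

lemma pow_divides_mult_iff_trunc_val:
  assumes p: "p \<in> carrier R" "ring_prime p" and x: "x \<in> carrier R" and y: "y \<in> carrier R"
  shows "p [^] m divides x \<otimes> y \<longleftrightarrow> m \<le> trunc_val R p m x + trunc_val R p m y"
proof -
  define a b where "a = trunc_val R p m x" and "b = trunc_val R p m y"
  obtain x' where x': "x' \<in> carrier R" "x = p [^] a \<otimes> x'"
    using trunc_val_le(2)[of p x m] p x unfolding a_def by blast
  obtain y' where y': "y' \<in> carrier R" "y = p [^] b \<otimes> y'"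
    using trunc_val_le(2)[of p y m] p y unfolding b_def by blast
  have xy: "x \<otimes> y = p [^] (a + b) \<otimes> (x' \<otimes> y')"
    using x' y' p by (simp add: nat_pow_mult[symmetric] m_ac)
  show ?thesis
  proof
    assume dvd: "p [^] m divides x \<otimes> y"
    show "m \<le> trunc_val R p m x + trunc_val R p m y"
    proof (rule ccontr)
      assume "\<not> ?thesis"
      then have lt: "a + b < m" by (simp add: a_def b_def)
      have "p [^] Suc (a + b) divides x \<otimes> y"
        by (rule divides_trans[OF pow_divides_pow dvd]) (use lt p in auto)
      then have "p [^] (a + b) \<otimes> p divides p [^] (a + b) \<otimes> (x' \<otimes> y')"
        by (simp add: xy)
      \<comment> \<open>Powers of a nonzero element stay in \<open>mult_of R\<close>, so they are
        nonzero.\<close>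
      moreover have "p [^] (a + b) \<noteq> \<zero>"
        using p ring_primeE(1)[OF p] nat_pow_mult_of[of R] mult_of.nat_pow_closed[of p "a + b"]
        by auto
      ultimately have "p divides x' \<otimes> y'"
        using mult_divides[of p "x' \<otimes> y'" "p [^] (a + b)"] p x' y' by auto
      then have "p divides x' \<or> p divides y'"
        using ring_prime_divides_mult p x' y' by blast
      \<comment> \<open>As a + b < m, both \<open>Suc a\<close> and \<open>Suc b\<close> are at most
        \<open>m\<close>, so either divisibility contradicts maximality.\<close>
      then have "p [^] Suc a divides x \<or> p [^] Suc b divides y"
        using divides_mult p x' y' by auto
      then show False
        using pow_divides_iff_trunc_val[OF p(1) x, of "Suc a" m]
          pow_divides_iff_trunc_val[OF p(1) y, of "Suc b" m] lt
        by (auto simp: a_def b_def)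
    qed
  next
    assume "m \<le> trunc_val R p m x + trunc_val R p m y"
    then have "m \<le> a + b" by (simp add: a_def b_def)
    then show "p [^] m divides x \<otimes> y"
      unfolding xy using p x' y' by (intro divides_prod_r pow_divides_pow) auto
  qed
qed

section \<open>Products of powers of pairwise non-associated primes\<close>

lemma finprod_prime_pow_not_divisible:
  assumes "finite S" "q \<in> carrier R" "ring_prime q"
    and "\<And>i. i \<in> S \<Longrightarrow> p i \<in> carrier R \<and> ring_prime (p i) \<and> \<not> q \<sim> p i"
  shows "\<not> q divides (\<Otimes>i\<in>S. p i [^] (k i :: nat))"
proof
  assume "q divides (\<Otimes>i\<in>S. p i [^] k i)"
  then obtain i where "i \<in> S" "q divides p i [^] k i"
    using ring_prime_divides_finprod[OF assms(1-3), of "\<lambda>i. p i [^] k i"] assms(4) by blast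
  then show False
    using ring_prime_divides_pow[OF assms(2,3), of "p i" "k i"]
      ring_prime_divides_ring_prime[OF assms(2,3), of "p i"] assms(4)[of i] by simp
qed

text \<open>Powers of non-associated primes are coprime: once the product over \<open>S\<close> is
  split off from \<open>x\<close>, the new prime does not divide that product, so its power must
  divide the cofactor.\<close>

lemma finprod_prime_pow_divides_iff:
  assumes "finite S" "x \<in> carrier R"
    and p: "\<And>i. i \<in> S \<Longrightarrow> p i \<in> carrier R \<and> ring_prime (p i)"
    and "\<And>i j. i \<in> S \<Longrightarrow> j \<in> S \<Longrightarrow> i \<noteq> j \<Longrightarrow> \<not> p i \<sim> p j"
  shows "(\<Otimes>i\<in>S. p i [^] (k i :: nat)) divides x \<longleftrightarrow> (\<forall>i\<in>S. p i [^] k i divides x)"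
  using assms(1,3,4)
proof (induction S)
  case empty
  then show ?case using one_divides assms(2) by simp
next
  case (insert j S)
  let ?P = "\<Otimes>i\<in>S. p i [^] k i"
  have carr: "?P \<in> carrier R" "p j [^] k j \<in> carrier R"
    using insert.prems(1) by auto
  have prod: "(\<Otimes>i\<in>insert j S. p i [^] k i) = p j [^] k j \<otimes> ?P"
    using insert by (intro finprod_insert) auto
  have IH: "?P divides x \<longleftrightarrow> (\<forall>i\<in>S. p i [^] k i divides x)"
    using insert by auto
  have nd: "\<not> p j divides ?P"
    using insert by (intro finprod_prime_pow_not_divisible) auto
  show ?case unfolding prod
  proof
    assume dvd: "p j [^] k j \<otimes> ?P divides x"
    have "p j [^] k j divides p j [^] k j \<otimes> ?P" "?P divides p j [^] k j \<otimes> ?P"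
      using carr divides_prod_r divides_prod_l divides_refl by blast+
    then have "p j [^] k j divides x" "?P divides x"
      using divides_trans dvd carr by blast+
    with IH show "\<forall>i\<in>insert j S. p i [^] k i divides x" by simp
  next
    assume all: "\<forall>i\<in>insert j S. p i [^] k i divides x"
    with IH obtain y where y: "y \<in> carrier R" "x = ?P \<otimes> y" by auto
    have "p j [^] k j divides y"
      using ring_prime_pow_divides_cancel[of "p j" ?P y "k j"] nd carr y all insert.prems(1)
      by auto
    then have "?P \<otimes> p j [^] k j divides ?P \<otimes> y"
      using divides_mult carr by blast
    then show "p j [^] k j \<otimes> ?P divides x"
      using y carr m_comm by simp
  qed
qed

text \<open>Every vector of exponents is realised by a product. One more factor \<open>p j\<close>
  would, after cancellation, have to divide the product over the other indices.\<close>

lemma trunc_val_finprod_prime_pow: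
  assumes "finite S" "j \<in> S" "k j \<le> m"
    and p: "\<And>i. i \<in> S \<Longrightarrow> p i \<in> carrier R \<and> ring_prime (p i)"
    and na: "\<And>i j. i \<in> S \<Longrightarrow> j \<in> S \<Longrightarrow> i \<noteq> j \<Longrightarrow> \<not> p i \<sim> p j"
  shows "trunc_val R (p j) m (\<Otimes>i\<in>S. p i [^] k i) = k j"
proof -
  let ?P = "\<Otimes>i\<in>S - {j}. p i [^] k i" and ?x = "\<Otimes>i\<in>S. p i [^] k i"
  have carr: "?P \<in> carrier R" "p j \<in> carrier R" "?x \<in> carrier R"
    using p assms(2) by auto
  have "insert j (S - {j}) = S" using assms(2) by auto
  then have prod: "?x = p j [^] k j \<otimes> ?P"
    using finprod_insert[of "S - {j}" j "\<lambda>i. p i [^] k i"] assms(1,2) p by auto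
  have nd: "\<not> p j divides ?P"
    using assms by (intro finprod_prime_pow_not_divisible) auto
  have "p j [^] k j divides ?x"
    unfolding prod using carr by (intro divides_prod_r) auto
  then have "k j \<le> trunc_val R (p j) m ?x"
    using pow_divides_iff_trunc_val carr assms(3) by blast
  moreover have "\<not> Suc (k j) \<le> trunc_val R (p j) m ?x"
  proof
    assume le: "Suc (k j) \<le> trunc_val R (p j) m ?x"
    have "Suc (k j) \<le> m" using le trunc_val_le(1)[OF carr(2,3), of m] by simp
    then have "p j [^] Suc (k j) divides ?x"
      using pow_divides_iff_trunc_val[OF carr(2,3)] le by blast
    then have "p j [^] k j \<otimes> p j divides p j [^] k j \<otimes> ?P" by (simp add: prod)
    moreover have "p j [^] k j \<noteq> \<zero>"
      using carr ring_primeE(1)[of "p j"] p[OF assms(2)] nat_pow_mult_of[of R]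
        mult_of.nat_pow_closed[of "p j" "k j"] by auto
    ultimately show False
      using mult_divides[of "p j" ?P "p j [^] k j"] nd carr by auto
  qed
  ultimately show ?thesis by simp
qed

end

section \<open>Zero divisor graphs\<close>

text \<open>The ring enters only through a map to vectors that fills the whole box, sends exactly
  zero to m, and detects vanishing products by coordinatewise sums.\<close>

lemma twin_reduction_zero_divisor_graph_isomorphic:
  fixes Q :: "('a, 'b) ring_scheme" (structure)
    and E :: "'a \<Rightarrow> nat \<Rightarrow> nat" and n :: nat and m :: "nat \<Rightarrow> nat"
  assumes n: "n \<ge> 3" and m: "\<And>i. i \<in> {1..n} \<Longrightarrow> m i \<ge> 1"
    and E: "E ` carrier Q = (\<Pi>\<^sub>E i\<in>{1..n}. {0..m i})"
    and zero: "\<And>x. x \<in> carrier Q \<Longrightarrow> x = \<zero> \<longleftrightarrow> E x = (\<lambda>i\<in>{1..n}. m i)"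
    and mult: "\<And>x y. x \<in> carrier Q \<Longrightarrow> y \<in> carrier Q \<Longrightarrow>
                 x \<otimes> y = \<zero> \<longleftrightarrow> (\<forall>i\<in>{1..n}. m i \<le> E x i + E y i)"
  shows "graph_isomorphic (twin_reduction (zero_divisor_graph Q)) (integral_covering_graph n m)"
proof -
  let ?D = "integral_covering_graph n m"
  let ?P = "\<lambda>a b. \<forall>i\<in>{1..n}. m i \<le> a i + b i"
  have vertsD: "sverts ?D = (\<Pi>\<^sub>E i\<in>{1..n}. {0..m i}) - {\<lambda>i\<in>{1..n}. 0, \<lambda>i\<in>{1..n}. m i}"
    by (simp add: integral_covering_graph_def)
  have ED: "E x \<in> (\<Pi>\<^sub>E i\<in>{1..n}. {0..m i})" if "x \<in> carrier Q" for x using E that by blast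
  have zd: "x \<in> zero_divisors Q \<longleftrightarrow> E x \<noteq> (\<lambda>i\<in>{1..n}. 0)" if x: "x \<in> carrier Q" for x
  proof
    assume "x \<in> zero_divisors Q"
    then obtain s where s: "s \<in> carrier Q" "s \<noteq> \<zero>" "x \<otimes> s = \<zero>"
      by (auto simp: zero_divisors_def)
    show "E x \<noteq> (\<lambda>i\<in>{1..n}. 0)"
    proof
      assume "E x = (\<lambda>i\<in>{1..n}. 0)"
      then have "\<forall>i\<in>{1..n}. m i \<le> E s i" using mult[OF x s(1)] s(3) by auto
      then have "E s = (\<lambda>i\<in>{1..n}. m i)"
        using ED[OF s(1)] by (intro PiE_ext[of _ "{1..n}"]) (auto simp: PiE_iff intro: antisym)
      then show False using s zero by blast
    qed
  next
    assume ne: "E x \<noteq> (\<lambda>i\<in>{1..n}. 0)"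
    have "\<exists>i\<in>{1..n}. E x i \<noteq> 0"
    proof (rule ccontr)
      assume "\<not> ?thesis"
      then have "E x = (\<lambda>i\<in>{1..n}. 0)"
        using ED[OF x] by (intro extensionalityI[of _ "{1..n}"]) (auto simp: PiE_iff)
      with ne show False ..
    qed
    then obtain i where i: "i \<in> {1..n}" "E x i > 0" by blast
    \<comment> \<open>An element with the complementary vector annihilates \<open>x\<close>. It is
      nonzero because entry i lies strictly below m i, as E x i > 0 and m i >= 1.\<close>
    have "(\<lambda>i\<in>{1..n}. m i - E x i) \<in> (\<Pi>\<^sub>E i\<in>{1..n}. {0..m i})" by auto
    then obtain s where s: "s \<in> carrier Q" "E s = (\<lambda>i\<in>{1..n}. m i - E x i)"
      using E by (metis (no_types, lifting) imageE)
    have "E s i \<noteq> m i" using s(2) i m[of i] by simp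
    then have "s \<noteq> \<zero>" using zero[OF s(1)] i by auto
    moreover have "x \<otimes> s = \<zero>" using mult[OF x s(1)] s(2) by auto
    ultimately show "x \<in> zero_divisors Q" using x s(1) by (auto simp: zero_divisors_def)
  qed
  have verts: "x \<in> sverts (zero_divisor_graph Q) \<longleftrightarrow> x \<in> carrier Q \<and> E x \<in> sverts ?D" for x
  proof -
    have "x \<in> sverts (zero_divisor_graph Q) \<longleftrightarrow> x \<in> carrier Q \<and> x \<in> zero_divisors Q \<and> x \<noteq> \<zero>"
      by (auto simp: zero_divisor_graph_def zero_divisors_def)
    then show ?thesis unfolding vertsD using zd zero ED by auto
  qed
  \<comment> \<open>Symmetry of vanishing products is read off from the symmetric sum of
    vectors.\<close>
  have comm: "x \<otimes> y = \<zero> \<longleftrightarrow> y \<otimes> x = \<zero>" if "x \<in> carrier Q" "y \<in> carrier Q" for x y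
    using that mult by (simp add: add.commute)
  have edges: "{x, y} \<in> sedges (zero_divisor_graph Q) \<longleftrightarrow>
      x \<in> sverts (zero_divisor_graph Q) \<and> y \<in> sverts (zero_divisor_graph Q) \<and> x \<noteq> y \<and> x \<otimes> y = \<zero>"
    for x y
  proof -
    let ?V = "sverts (zero_divisor_graph Q)"
    have "sedges (zero_divisor_graph Q) =
        {{r, s} | r s. r \<in> ?V \<and> s \<in> ?V \<and> r \<noteq> s \<and> r \<otimes> s = \<zero>}"
      by (simp add: zero_divisor_graph_def Let_def)
    moreover have "x \<otimes> y = \<zero> \<longleftrightarrow> y \<otimes> x = \<zero>" if "x \<in> ?V" "y \<in> ?V" for x y
      using that comm verts by blast
    ultimately show ?thesis by (auto simp: doubleton_eq_iff)
  qed
  show ?thesis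
  proof (rule twin_reduction_isomorphicI[where f = E and P = ?P])
    show "E ` sverts (zero_divisor_graph Q) = sverts ?D"
    proof
      show "sverts ?D \<subseteq> E ` sverts (zero_divisor_graph Q)"
      proof
        fix a assume a: "a \<in> sverts ?D"
        then have "a \<in> E ` carrier Q" unfolding E vertsD by blast
        with a verts show "a \<in> E ` sverts (zero_divisor_graph Q)" by blast
      qed
    qed (use verts in blast)
  next
    fix a b assume "a \<in> sverts ?D" "b \<in> sverts ?D"
    then show "{a, b} \<in> sedges ?D \<longleftrightarrow> a \<noteq> b \<and> ?P a b"
      by (auto simp: integral_covering_graph_def Let_def doubleton_eq_iff add.commute)
  next
    fix a b assume "a \<in> sverts ?D" "b \<in> sverts ?D" "a \<noteq> b"
    then show "\<exists>c\<in>sverts ?D - {a, b}. ?P a c \<noteq> ?P b c"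
      using integral_covering_graph_separated[of n m a b] n m by blast
  qed (use edges verts mult in auto)
qed

theorem corollary73:
  fixes R :: "('a, 'b) ring_scheme" (structure)
    and I :: "'a set" and g u :: 'a
    and n :: nat and p :: "nat \<Rightarrow> 'a" and m :: "nat \<Rightarrow> nat"
  assumes "principal_domain R"
    and "g \<in> carrier R" and "I = PIdl g"
    and "I \<noteq> carrier R" and "\<not> primeideal I R"
    and "finite (carrier (R Quot I))"
    and "u \<in> Units R"
    and "\<And>i. i \<in> {1..n} \<Longrightarrow> p i \<in> carrier R \<and> ring_prime (p i)"
    and "\<And>i j. i \<in> {1..n} \<Longrightarrow> j \<in> {1..n} \<Longrightarrow> i \<noteq> j \<Longrightarrow> \<not> p i \<sim> p j"
    and "\<And>i. i \<in> {1..n} \<Longrightarrow> m i \<ge> 1"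
    and "g = u \<otimes> (\<Otimes>i\<in>{1..n}. p i [^] m i)"
    and "n \<ge> 3"
  shows "graph_isomorphic (twin_reduction (zero_divisor_graph (R Quot I)))
           (integral_covering_graph n m)"
proof -
  interpret principal_domain R by fact
  interpret ideal I R unfolding assms(3) by (rule cgenideal_ideal[OF assms(2)])
  note p = assms(8) and na = assms(9)
  let ?P = "\<Otimes>i\<in>{1..n}. p i [^] m i"
  have Pc: "?P \<in> carrier R" using p by auto
  have "g \<sim> ?P" using ring_associated_iff[OF assms(2) Pc] assms(7,11) by blast
  then have g_dvd: "g divides x \<longleftrightarrow> ?P divides x" if "x \<in> carrier R" for x
    using that assms(2) Pc by (meson associated_def divides_trans)
  \<comment> \<open>Vanishing in the quotient splits into independent conditions, one for each
    prime.\<close>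
  have mem_I: "x \<in> I \<longleftrightarrow> (\<forall>i\<in>{1..n}. p i [^] m i divides x)" if x: "x \<in> carrier R" for x
  proof -
    have "x \<in> I \<longleftrightarrow> g divides x"
      unfolding assms(3) cgenideal_def factor_def using m_comm assms(2) by auto
    then show ?thesis
      using g_dvd[OF x] finprod_prime_pow_divides_iff[of "{1..n}" x p m] x p na by auto
  qed
  define val where "val x = (\<lambda>i\<in>{1..n}. trunc_val R (p i) (m i) x)" for x
  \<comment> \<open>A coset has no canonical representative; one is chosen, and
    \<open>val_eq\<close> makes the choice immaterial.\<close>
  define E where "E A = val (SOME x. x \<in> carrier R \<and> A = I +> x)" for A
  have val_eq: "val x = val y"
    if x: "x \<in> carrier R" and y: "y \<in> carrier R" and eq: "I +> x = I +> y" for x y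
  proof -
    have sub: "x \<ominus> y \<in> I"
      using quotient_eq_iff_same_a_r_cos[OF ideal_axioms x y] eq by simp
    have "trunc_val R (p i) (m i) x = trunc_val R (p i) (m i) y" if i: "i \<in> {1..n}" for i
    proof -
      have dvd: "p i [^] m i divides (x \<ominus> y)" using sub mem_I[of "x \<ominus> y"] x y i by simp
      \<comment> \<open>Only exponents up to \<open>m i\<close> enter \<open>trunc_val\<close>, and
        for these the power divides the difference of x and y, so it divides both or
        neither.\<close>
      have "p i [^] k divides x \<longleftrightarrow> p i [^] k divides y" if "k \<le> m i" for k
      proof -
        have d: "p i [^] k divides (x \<ominus> y)"
          using divides_trans[OF pow_divides_pow dvd] that p[OF i] by simp
        then obtain z where z: "z \<in> carrier R" "x \<ominus> y = p i [^] k \<otimes> z" by blast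
        have q: "p i [^] k \<in> carrier R" using p[OF i] by simp
        have xe: "x = y \<oplus> p i [^] k \<otimes> z" and ye: "y = x \<ominus> p i [^] k \<otimes> z"
          using x y unfolding z(2)[symmetric] by algebra+
        show ?thesis
        proof
          assume "p i [^] k divides x"
          then obtain w where w: "w \<in> carrier R" "x = p i [^] k \<otimes> w" by blast
          have "y = p i [^] k \<otimes> (w \<ominus> z)" using ye w z q by algebra
          then show "p i [^] k divides y" using w z by blast
        next
          assume "p i [^] k divides y"
          then obtain w where w: "w \<in> carrier R" "y = p i [^] k \<otimes> w" by blast
          have "x = p i [^] k \<otimes> (w \<oplus> z)" using xe w z q by algebra
          then show "p i [^] k divides x" using w z by blast
        qed
      qed
      then have "{k. k \<le> m i \<and> p i [^] k divides x} = {k. k \<le> m i \<and> p i [^] k divides y}" by blast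
      then show ?thesis by (simp add: trunc_val_def)
    qed
    then show ?thesis by (auto simp: val_def)
  qed
  have E: "E (I +> x) = val x" if x: "x \<in> carrier R" for x
  proof -
    have "\<exists>y. y \<in> carrier R \<and> I +> x = I +> y" using x by blast
    then have "(SOME y. y \<in> carrier R \<and> I +> x = I +> y) \<in> carrier R \<and>
        I +> x = I +> (SOME y. y \<in> carrier R \<and> I +> x = I +> y)" by (rule someI_ex)
    then show ?thesis using val_eq[OF x] unfolding E_def by metis
  qed
  have carrier: "carrier (R Quot I) = (\<lambda>x. I +> x) ` carrier R"
    by (auto simp: FactRing_simps)
  have zero_iff: "I +> x = \<zero>\<^bsub>R Quot I\<^esub> \<longleftrightarrow> (\<forall>i\<in>{1..n}. p i [^] m i divides x)"
    if x: "x \<in> carrier R" for x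
  proof -
    have "I +> x = I \<longleftrightarrow> x \<in> I" using x rcos_const_imp_mem a_rcos_const by blast
    then show ?thesis using mem_I x by (simp add: FactRing_def)
  qed
  show ?thesis
  proof (rule twin_reduction_zero_divisor_graph_isomorphic[where E = E])
    show "E ` carrier (R Quot I) = (\<Pi>\<^sub>E i\<in>{1..n}. {0..m i})"
    proof
      show "E ` carrier (R Quot I) \<subseteq> (\<Pi>\<^sub>E i\<in>{1..n}. {0..m i})"
        using p by (auto simp: carrier E val_def)
      show "(\<Pi>\<^sub>E i\<in>{1..n}. {0..m i}) \<subseteq> E ` carrier (R Quot I)"
      proof
        fix c assume c: "c \<in> (\<Pi>\<^sub>E i\<in>{1..n}. {0..m i})"
        \<comment> \<open>The product with exponents \<open>c\<close> is a preimage: no entry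
          exceeds its bound, so truncation leaves the valuations intact.\<close>
        let ?x = "\<Otimes>i\<in>{1..n}. p i [^] c i"
        have x: "?x \<in> carrier R" using p by auto
        have "val ?x i = c i" if "i \<in> {1..n}" for i
          using trunc_val_finprod_prime_pow[of "{1..n}" i c "m i" p] c p na that
          by (auto simp: val_def PiE_iff)
        then have "val ?x = c"
          using c by (intro extensionalityI[of _ "{1..n}"]) (auto simp: val_def PiE_iff)
        then have "c = E (I +> ?x)" using E[OF x] by simp
        then show "c \<in> E ` carrier (R Quot I)"
          unfolding carrier by (rule image_eqI[OF _ imageI[OF x]])
      qed
    qed
  next
    fix A assume "A \<in> carrier (R Quot I)"
    then obtain x where x: "x \<in> carrier R" "A = I +> x" unfolding carrier by blast
    have "p i [^] m i divides x \<longleftrightarrow> val x i = m i" if i: "i \<in> {1..n}" for i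
    proof -
      have "trunc_val R (p i) (m i) x \<le> m i" using p[OF i] x by simp
      then show ?thesis
        using pow_divides_iff_trunc_val[of "p i" x "m i" "m i"] p[OF i] x i
        by (auto simp: val_def intro: antisym)
    qed
    then have "A = \<zero>\<^bsub>R Quot I\<^esub> \<longleftrightarrow> (\<forall>i\<in>{1..n}. val x i = m i)"
      unfolding x(2) zero_iff[OF x(1)] by blast
    also have "\<dots> \<longleftrightarrow> val x = (\<lambda>i\<in>{1..n}. m i)"
      by (auto simp: val_def fun_eq_iff)
    finally show "A = \<zero>\<^bsub>R Quot I\<^esub> \<longleftrightarrow> E A = (\<lambda>i\<in>{1..n}. m i)"
      using E x by simp
  next
    fix A B assume "A \<in> carrier (R Quot I)" "B \<in> carrier (R Quot I)"
    then obtain x y where xy: "x \<in> carrier R" "y \<in> carrier R" "A = I +> x" "B = I +> y"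
      unfolding carrier by blast
    have "A \<otimes>\<^bsub>R Quot I\<^esub> B = I +> (x \<otimes> y)"
      using xy rcoset_mult_add by (simp add: FactRing_def)
    then have "A \<otimes>\<^bsub>R Quot I\<^esub> B = \<zero>\<^bsub>R Quot I\<^esub> \<longleftrightarrow> (\<forall>i\<in>{1..n}. p i [^] m i divides x \<otimes> y)"
      using zero_iff xy by simp
    also have "\<dots> \<longleftrightarrow> (\<forall>i\<in>{1..n}. m i \<le> val x i + val y i)"
      using pow_divides_mult_iff_trunc_val p xy by (simp add: val_def)
    finally show "A \<otimes>\<^bsub>R Quot I\<^esub> B = \<zero>\<^bsub>R Quot I\<^esub> \<longleftrightarrow> (\<forall>i\<in>{1..n}. m i \<le> E A i + E B i)"
      using E xy by simp
  qed (use assms in auto)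
qed

end
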